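(* Let $a<b$ be integers, $\chi(x)=(x-a)(x-b)$ and $R=\mathbb{Z}[x]/(\chi(x))$. If $b-a\leq 2$, then $\mathrm{Cl}(R)$ is the trivial group. If $b-a>2$, then $\mathrm{Cl}(R)$ is isomorphic to the quotient of $(\mathbb{Z}/(b-a))^\times$ by the subgroup $\{\pm 1\}$.
   Context: Put $K=\mathbb{Q}\otimes_{\mathbb{Z}}R\cong\mathbb{Q}[x]/(\chi(x))$. A fractional $R$-ideal is an $R$-submodule $I\subset K$ that is a free $\mathbb{Z}$-module of rank $2$. Fractional ideals are multiplied in the usual way. Two fractional $R$-ideals $I,J$ are equivalent if $I=kJ$ for some $k\in K^\times$. The ideal class monoid $\mathrm{ICM}(R)$ is the monoid of equivalence classes of fractional $R$-ideals. A fractional $R$-ideal $I$ is invertible if $IJ=R$ for some fractional $R$-ideal $J$. The ideal class group $\mathrm{Cl}(R)$ is the subgroup of $\mathrm{ICM}(R)$ consisting of classes of invertible fractional $R$-ideals. *)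

theory Defs
  imports
    "HOL-Algebra.Algebra"
    "HOL-Algebra.Free_Abelian_Groups"
    "HOL-Algebra.Algebraic_Closure_Type"
    "HOL-Computational_Algebra.Polynomial"
    "HOL-Number_Theory.Residues"
begin

definition chi :: "int \<Rightarrow> int \<Rightarrow> int poly" where
  "chi a b = [:- a, 1:] * [:- b, 1:]"

abbreviation ZX :: "int poly ring" where
  "ZX \<equiv> ring_of_type_algebra"

abbreviation QX :: "rat poly ring" where
  "QX \<equiv> ring_of_type_algebra"

abbreviation rat_of_int_poly :: "int poly \<Rightarrow> rat poly" where
  "rat_of_int_poly \<equiv> map_poly rat_of_int"

text \<open>In the following, \<open>f\<close> is a monic polynomial of degree 2, \<open>R = \<int>[x]/(f)\<close>, and
  \<open>K = \<rat> \<otimes> R\<close> is taken in the form \<open>\<rat>[x]/(f)\<close>.\<close>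

definition order_ring :: "int poly \<Rightarrow> int poly set ring" where
  "order_ring f = ZX Quot (PIdl\<^bsub>ZX\<^esub> f)"

definition algebra_ring :: "int poly \<Rightarrow> rat poly set ring" where
  "algebra_ring f = QX Quot (PIdl\<^bsub>QX\<^esub> (rat_of_int_poly f))"

text \<open>The canonical map \<open>R \<rightarrow> K\<close>. All cosets in the union are equal, see
  \<open>embed_coset\<close> below.\<close>

definition embed :: "int poly \<Rightarrow> int poly set \<Rightarrow> rat poly set" where
  "embed f C = (\<Union>p\<in>C. PIdl\<^bsub>QX\<^esub> (rat_of_int_poly f) +>\<^bsub>QX\<^esub> rat_of_int_poly p)"

definition algebra_module :: "int poly \<Rightarrow> (int poly set, rat poly set) module" where
  "algebra_module f =
     \<lparr>carrier = carrier (algebra_ring f),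
      monoid.mult = monoid.mult (algebra_ring f),
      one = \<one>\<^bsub>algebra_ring f\<^esub>,
      ring.zero = \<zero>\<^bsub>algebra_ring f\<^esub>,
      add = ring.add (algebra_ring f),
      module.smult = (\<lambda>r x. embed f r \<otimes>\<^bsub>algebra_ring f\<^esub> x)\<rparr>"

definition fractional_ideal :: "int poly \<Rightarrow> rat poly set set \<Rightarrow> bool" where
  "fractional_ideal f I \<longleftrightarrow>
     submodule I (order_ring f) (algebra_module f) \<and>
     (add_monoid (algebra_ring f))\<lparr>carrier := I\<rparr> \<cong> free_Abelian_group {..<2::nat}"

definition unit_ideal :: "int poly \<Rightarrow> rat poly set set" where
  "unit_ideal f = embed f ` carrier (order_ring f)"

definition invertible_ideal :: "int poly \<Rightarrow> rat poly set set \<Rightarrow> bool" where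
  "invertible_ideal f I \<longleftrightarrow> fractional_ideal f I \<and>
     (\<exists>J. fractional_ideal f J \<and> ideal_prod (algebra_ring f) I J = unit_ideal f)"

definition ideal_equiv :: "int poly \<Rightarrow> (rat poly set set \<times> rat poly set set) set" where
  "ideal_equiv f = {(I, J). fractional_ideal f I \<and> fractional_ideal f J \<and>
     (\<exists>k\<in>Units (algebra_ring f). I = k <#\<^bsub>algebra_ring f\<^esub> J)}"

text \<open>The product of two classes is the class of \<open>I J\<close> for any representatives \<open>I\<close>, \<open>J\<close>;
  the union below is over equal classes, since \<open>(k I) (l J) = (k l) (I J)\<close>.\<close>

definition ICM :: "int poly \<Rightarrow> rat poly set set set monoid" where
  "ICM f =
     \<lparr>carrier = {I. fractional_ideal f I} // ideal_equiv f,
      monoid.mult = (\<lambda>A B. \<Union>I\<in>A. \<Union>J\<in>B. ideal_equiv f `` {ideal_prod (algebra_ring f) I J}),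
      one = ideal_equiv f `` {unit_ideal f}\<rparr>"

definition class_group :: "int poly \<Rightarrow> rat poly set set set monoid" where
  "class_group f = (ICM f)\<lparr>carrier := {I. invertible_ideal f I} // ideal_equiv f\<rparr>"

lemma coset_eq_range:
  fixes g h :: "'a :: comm_ring_1 poly"
  shows "PIdl\<^bsub>ring_of_type_algebra\<^esub> g +>\<^bsub>ring_of_type_algebra\<^esub> h = range (\<lambda>s. s * g + h)"
  by (auto simp: a_r_coset_def r_coset_def cgenideal_def ring_of_type_algebra_def)

lemma embed_coset:
  "embed f (PIdl\<^bsub>ZX\<^esub> f +>\<^bsub>ZX\<^esub> p) = PIdl\<^bsub>QX\<^esub> (rat_of_int_poly f) +>\<^bsub>QX\<^esub> rat_of_int_poly p"
proof -
  have *: "range (\<lambda>s. s * g + (q * g + h)) = range (\<lambda>s. s * g + h)" for g q h :: "rat poly"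
  proof (intro equalityI subsetI; elim rangeE)
    fix x s assume "x = s * g + (q * g + h)"
    then have "x = (s + q) * g + h" by (simp add: algebra_simps)
    then show "x \<in> range (\<lambda>s. s * g + h)" by blast
  next
    fix x s assume "x = s * g + h"
    then have "x = (s - q) * g + (q * g + h)" by (simp add: algebra_simps)
    then show "x \<in> range (\<lambda>s. s * g + (q * g + h))" by blast
  qed
  have hom: "rat_of_int_poly (q * f + p) = rat_of_int_poly q * rat_of_int_poly f + rat_of_int_poly p"
    for q
    by (rule poly_eqI) (simp add: coeff_map_poly coeff_mult)
  show ?thesis
    by (simp add: embed_def coset_eq_range hom *)
qed

end

theory Submission
  imports Defs
begin

text \<open>
  Evaluation at \<open>a\<close> and \<open>b\<close> identifies \<open>K = \<rat>[x]/(\<chi>)\<close> with \<open>\<rat> \<times> \<rat>\<close>, and \<open>R\<close> with the order of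
  all integer pairs \<open>(u, v)\<close> such that \<open>u \<equiv> v\<close> modulo \<open>m = b - a\<close>. For every integer \<open>t\<close> the
  lattice \<open>std t\<close> of integer pairs with \<open>v \<equiv> t u (mod m)\<close> is a fractional ideal, and if \<open>s\<close> is
  prime to \<open>m\<close>, then \<open>std t \<cdot> std s = std (t s)\<close> (\<open>ideal_prod_std\<close>). As \<open>std 1\<close> is \<open>R\<close> itself, this
  makes \<open>std t\<close> invertible whenever \<open>t\<close> is a unit modulo \<open>m\<close>, and \<open>t \<mapsto> [std t]\<close> is a homomorphism
  from \<open>(\<int>/m)\<^sup>\<times>\<close> to the class group.

  It is surjective (\<open>invertible_ideal_scaled_std\<close>). Let \<open>I J = R\<close>. Each coordinate projection of
  \<open>I\<close>, multiplied by a suitable coordinate of an element of \<open>J\<close>, is a nonzero subgroup of \<open>\<int>\<close>. It is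
  therefore infinite cyclic, and a factor from \<open>K\<^sup>\<times>\<close> turns both projections of \<open>I\<close> into \<open>\<int>\<close>. Then
  \<open>J\<close> contains some \<open>(1, k)\<close> with integral \<open>k\<close>. Multiplying \<open>(u, v) \<in> I\<close> by it lands in \<open>R\<close>, so
  \<open>v k \<equiv> u\<close>. An element \<open>(1, t)\<close> of \<open>I\<close> shows that \<open>t\<close> is inverse to \<open>k\<close>, whence \<open>v \<equiv> t u\<close>
  and \<open>I \<subseteq> std t\<close>. The reverse inclusion holds because \<open>I\<close> contains \<open>(1, t)\<close> and, as a multiple
  by \<open>(0, m) \<in> R\<close> of an element with second coordinate \<open>1\<close>, also \<open>(0, m)\<close>.

  The kernel is \<open>{\<plusminus>1}\<close> (\<open>std_class_eq_iff\<close>): a factor \<open>(p, q)\<close> carrying \<open>std t\<close> to \<open>std s\<close> preserves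
  both projections \<open>\<int>\<close>, so \<open>p\<close> and \<open>q\<close> are \<open>\<plusminus>1\<close>, and then \<open>s \<equiv> \<plusminus>t\<close>. Conversely \<open>(1, -1)\<close> carries
  \<open>std t\<close> to \<open>std (-t)\<close>. For \<open>m \<le> 2\<close> every \<open>t\<close> prime to \<open>m\<close> is \<open>1\<close> modulo \<open>m\<close>.
\<close>

section \<open>Subgroups of the rationals with a common denominator\<close>

text \<open>If \<open>S r \<subseteq> \<int>\<close>, then division with remainder by the least positive \<open>d\<close> with \<open>d / r \<in> S\<close> shows
  that \<open>d / r\<close> generates \<open>S\<close>.\<close>

lemma cyclic_if_scaled_into_Ints:
  fixes S :: "rat set"
  assumes add: "\<And>x y. x \<in> S \<Longrightarrow> y \<in> S \<Longrightarrow> x + y \<in> S"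
    and smult: "\<And>n x. x \<in> S \<Longrightarrow> of_int n * x \<in> S"
    and ints: "\<And>x. x \<in> S \<Longrightarrow> x * r \<in> \<int>"
    and x0: "x0 \<in> S" "x0 * r \<noteq> 0"
  obtains c where "c \<noteq> 0" "S = range (\<lambda>n. of_int n * c)"
proof -
  let ?P = "\<lambda>d. d > 0 \<and> of_nat d / r \<in> S"
  have r: "r \<noteq> 0" using x0 by auto
  obtain k where k: "x0 * r = of_int k" using ints[OF x0(1)] by (rule Ints_cases)
  have "?P (nat \<bar>k\<bar>)"
  proof -
    have "(of_nat (nat \<bar>k\<bar>) :: rat) = of_int (sgn k) * of_int k"
      by (metis abs_ge_zero abs_sgn mult.commute nat_0_le of_int_mult of_int_of_nat_eq)
    then have "of_nat (nat \<bar>k\<bar>) / r = of_int (sgn k) * x0"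
      using r by (simp flip: k)
    then show ?thesis using smult[OF x0(1)] x0(2) k by auto
  qed
  then obtain d where d: "?P d" and least: "\<And>e. e < d \<Longrightarrow> \<not> ?P e"
    using exists_least_iff[of ?P] by blast
  have "S = range (\<lambda>n. of_int n * (of_nat d / r))"
  proof (intro equalityI subsetI)
    fix x assume x: "x \<in> S"
    then obtain n where n: "x * r = of_int n" using ints Ints_cases by metis
    have "x + of_int (- (n div int d)) * (of_nat d / r) \<in> S" using add smult x d by blast
    also have "x + of_int (- (n div int d)) * (of_nat d / r) = of_int (n - n div int d * int d) / r"
      using n r by (simp add: field_simps)
    also have "n - n div int d * int d = int (nat (n mod int d))"
      using d by (simp add: minus_div_mult_eq_mod)
    finally have "nat (n mod int d) = 0"
      using least[of "nat (n mod int d)"] d by (simp add: nat_less_iff)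
    then have "n = n div int d * int d"
      using d by (metis add.right_neutral div_mult_mod_eq nat_eq_iff2 nat_0_iff order_antisym pos_mod_sign of_nat_0_less_iff)
    then have "x = of_int (n div int d) * (of_nat d / r)"
      using n r by (metis nonzero_eq_divide_eq of_int_mult of_int_of_nat_eq times_divide_eq_right)
    then show "x \<in> range (\<lambda>n. of_int n * (of_nat d / r))" by blast
  next
    fix x assume "x \<in> range (\<lambda>n. of_int n * (of_nat d / r))"
    then show "x \<in> S" using smult d by blast
  qed
  then show ?thesis using that[of "of_nat d / r"] d r by simp
qed

section \<open>The split algebra as a product of two fields\<close>

locale split_quadratic =
  fixes a b :: int
  assumes a_less_b: "a < b"
begin

abbreviation "m \<equiv> b - a"
abbreviation "K \<equiv> algebra_ring (chi a b)"
abbreviation "R \<equiv> order_ring (chi a b)"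
abbreviation "M \<equiv> algebra_module (chi a b)"

text \<open>\<open>elt u v\<close> is the element of \<open>K\<close> with value \<open>u\<close> at \<open>a\<close> and \<open>v\<close> at \<open>b\<close>; the representative is
  the linear interpolation polynomial.\<close>

definition elt :: "rat \<Rightarrow> rat \<Rightarrow> rat poly set" where
  "elt u v = PIdl\<^bsub>QX\<^esub> (rat_of_int_poly (chi a b)) +>\<^bsub>QX\<^esub>
     ([:u:] + smult ((v - u) / of_int m) [:- of_int a, 1:])"

lemma rat_chi: "rat_of_int_poly (chi a b) = [:- of_int a, 1:] * [:- of_int b, 1:]"
  by (simp add: chi_def map_poly_pCons)

lemma chi_dvd_iff: "rat_of_int_poly (chi a b) dvd p \<longleftrightarrow> poly p (of_int a) = 0 \<and> poly p (of_int b) = 0"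
proof
  assume "rat_of_int_poly (chi a b) dvd p"
  then show "poly p (of_int a) = 0 \<and> poly p (of_int b) = 0"
    unfolding rat_chi by (auto elim!: dvdE simp del: mult_pCons_left)
next
  assume p: "poly p (of_int a) = 0 \<and> poly p (of_int b) = 0"
  then obtain q where q: "p = [:- of_int a, 1:] * q"
    by (metis poly_eq_0_iff_dvd dvdE)
  with p a_less_b have "poly q (of_int b) = 0" by auto
  then show "rat_of_int_poly (chi a b) dvd p"
    unfolding q rat_chi by (intro mult_dvd_mono) (simp_all add: poly_eq_0_iff_dvd)
qed

text \<open>The Chinese remainder theorem for the two linear factors: cosets of \<open>(\<chi>)\<close> are determined by
  the two values of a representative.\<close>

lemma coset_eq_iff:
  "PIdl\<^bsub>QX\<^esub> (rat_of_int_poly (chi a b)) +>\<^bsub>QX\<^esub> p = PIdl\<^bsub>QX\<^esub> (rat_of_int_poly (chi a b)) +>\<^bsub>QX\<^esub> q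
   \<longleftrightarrow> poly p (of_int a) = poly q (of_int a) \<and> poly p (of_int b) = poly q (of_int b)"
  (is "?P = ?Q \<longleftrightarrow> _")
proof -
  let ?g = "rat_of_int_poly (chi a b)"
  have "?P = ?Q \<longleftrightarrow> ?g dvd p - q"
  proof
    assume "?P = ?Q"
    then have "0 * ?g + p \<in> range (\<lambda>s. s * ?g + q)" by (metis coset_eq_range rangeI)
    then obtain s where "p = s * ?g + q" by auto
    then show "?g dvd p - q" by simp
  next
    assume "?g dvd p - q"
    then obtain r where r: "p - q = r * ?g" by (metis dvdE mult.commute)
    have "s * ?g + p = (s + r) * ?g + q" "s * ?g + q = (s - r) * ?g + p" for s
      using r by (simp_all add: algebra_simps)
    then show "?P = ?Q" unfolding coset_eq_range by (metis (mono_tags, lifting) rangeI rangeE subsetI subset_antisym)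
  qed
  then show ?thesis by (simp add: chi_dvd_iff)
qed

lemma interpolation:
  "poly ([:u:] + smult ((v - u) / of_int m) [:- of_int a, 1:]) (rat_of_int a) = u"
  "poly ([:u:] + smult ((v - u) / of_int m) [:- of_int a, 1:]) (rat_of_int b) = v"
  using a_less_b by (simp_all add: divide_simps) (simp add: algebra_simps)

lemma coset_eq_elt:
  "PIdl\<^bsub>QX\<^esub> (rat_of_int_poly (chi a b)) +>\<^bsub>QX\<^esub> p = elt (poly p (of_int a)) (poly p (of_int b))"
  unfolding elt_def coset_eq_iff by (simp only: interpolation simp_thms)

lemma poly_with_values:
  obtains p where "poly p (rat_of_int a) = u" "poly p (rat_of_int b) = v"
  using interpolation by blast

lemma elt_eq_iff [simp]: "elt u v = elt u' v' \<longleftrightarrow> u = u' \<and> v = v'"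
  by (metis coset_eq_iff coset_eq_elt poly_with_values)

lemma cring_QX: "cring QX" by (rule cring_from_type_algebra)

lemma ideal_chi: "ideal (PIdl\<^bsub>QX\<^esub> (rat_of_int_poly (chi a b))) QX"
  using cring.cgenideal_ideal[OF cring_QX] by (simp add: ring_of_type_algebra_def)

lemma cring_K: "cring K"
  unfolding algebra_ring_def by (rule ideal.quotient_is_cring[OF ideal_chi cring_QX])

lemma carrier_K: "carrier K = {elt u v | u v. True}"
proof -
  have "carrier K = {PIdl\<^bsub>QX\<^esub> (rat_of_int_poly (chi a b)) +>\<^bsub>QX\<^esub> p | p. True}"
    by (auto simp: algebra_ring_def FactRing_def A_RCOSETS_def' ring_of_type_algebra_def)
  then show ?thesis by (auto simp: coset_eq_elt) (metis poly_with_values)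
qed

lemma elt_in_K [simp]: "elt u v \<in> carrier K"
  by (auto simp: carrier_K)

lemma elt_mult [simp]: "elt u v \<otimes>\<^bsub>K\<^esub> elt u' v' = elt (u * u') (v * v')"
proof -
  obtain p where p: "poly p (rat_of_int a) = u" "poly p (rat_of_int b) = v" by (rule poly_with_values)
  obtain q where q: "poly q (rat_of_int a) = u'" "poly q (rat_of_int b) = v'" by (rule poly_with_values)
  have "p \<otimes>\<^bsub>QX\<^esub> q = p * q" by (simp add: ring_of_type_algebra_def)
  then show ?thesis
    using ideal.rcoset_mult_add[OF ideal_chi, of p q] coset_eq_elt[of p] coset_eq_elt[of q] coset_eq_elt[of "p * q"] p q
    by (simp add: algebra_ring_def FactRing_def ring_of_type_algebra_def)
qed

lemma elt_add [simp]: "elt u v \<oplus>\<^bsub>K\<^esub> elt u' v' = elt (u + u') (v + v')"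
proof -
  obtain p where p: "poly p (rat_of_int a) = u" "poly p (rat_of_int b) = v" by (rule poly_with_values)
  obtain q where q: "poly q (rat_of_int a) = u'" "poly q (rat_of_int b) = v'" by (rule poly_with_values)
  have "p \<oplus>\<^bsub>QX\<^esub> q = p + q" by (simp add: ring_of_type_algebra_def)
  have subgroup: "abelian_subgroup (PIdl\<^bsub>QX\<^esub> (rat_of_int_poly (chi a b))) QX"
    by (intro abelian_subgroupI3 ideal.axioms(1) ideal_chi ring.is_abelian_group cring.axioms(1) cring_QX)
  show ?thesis
    using \<open>p \<oplus>\<^bsub>QX\<^esub> q = p + q\<close> abelian_subgroup.a_rcos_sum[OF subgroup, of p q] coset_eq_elt[of p] coset_eq_elt[of q] coset_eq_elt[of "p + q"] p q
    by (simp add: algebra_ring_def FactRing_def ring_of_type_algebra_def)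
qed

lemma one_K: "\<one>\<^bsub>K\<^esub> = elt 1 1"
  using coset_eq_elt[of 1] by (simp add: algebra_ring_def FactRing_def ring_of_type_algebra_def)

lemma zero_K: "\<zero>\<^bsub>K\<^esub> = elt 0 0"
proof -
  interpret cring K by (rule cring_K)
  show ?thesis using r_zero[of "elt 0 0"] l_zero[of "elt 0 0"]
    by (metis a_comm add.l_cancel elt_add elt_in_K add_0 zero_closed)
qed

lemma Units_K: "Units K = {elt p q | p q. p \<noteq> 0 \<and> q \<noteq> 0}"
proof -
  have "elt p q \<in> Units K \<longleftrightarrow> p \<noteq> 0 \<and> q \<noteq> 0" for p q
  proof
    assume "elt p q \<in> Units K"
    then obtain x where "x \<in> carrier K" "elt p q \<otimes>\<^bsub>K\<^esub> x = \<one>\<^bsub>K\<^esub>" by (auto simp: Units_def)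
    then show "p \<noteq> 0 \<and> q \<noteq> 0" by (auto simp: carrier_K one_K)
  next
    assume "p \<noteq> 0 \<and> q \<noteq> 0"
    then show "elt p q \<in> Units K"
      by (auto simp: Units_def one_K intro!: bexI[of _ "elt (1/p) (1/q)"])
  qed
  moreover have "Units K \<subseteq> carrier K" by (auto simp: Units_def)
  ultimately show ?thesis by (force simp: carrier_K)
qed

text \<open>\<open>b - a\<close> divides \<open>p(b) - p(a)\<close> for every integer polynomial, and every pair of integers
  satisfying this congruence occurs already for a linear one.\<close>

lemma embed_R: "embed (chi a b) ` carrier R = {elt (of_int u) (of_int v) | u v. m dvd v - u}"
proof -
  have carrier_R: "carrier R = {PIdl\<^bsub>ZX\<^esub> (chi a b) +>\<^bsub>ZX\<^esub> p | p. True}"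
    by (auto simp: order_ring_def FactRing_def A_RCOSETS_def' ring_of_type_algebra_def)
  have ev: "poly (rat_of_int_poly p) (of_int x) = of_int (poly p x)" for p x
    by (induction p) (simp_all add: map_poly_pCons)
  have "embed (chi a b) (PIdl\<^bsub>ZX\<^esub> (chi a b) +>\<^bsub>ZX\<^esub> p) = elt (of_int (poly p a)) (of_int (poly p b))" for p
    unfolding embed_coset coset_eq_elt ev ..
  then have eq: "embed (chi a b) ` carrier R = {elt (of_int (poly p a)) (of_int (poly p b)) | p. True}"
    unfolding carrier_R by (auto simp: image_iff)
  have div: "m dvd poly p b - poly p a" for p
  proof (induction p)
    case (pCons c p)
    have "b * poly p b - a * poly p a = (b - a) * poly p b + a * (poly p b - poly p a)"
      by (simp add: algebra_simps)
    then show ?case using pCons by simp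
  qed simp
  have "\<exists>p. poly p a = u \<and> poly p b = v" if uv: "m dvd v - u" for u v
  proof -
    obtain w where w: "v - u = (b - a) * w" using uv by (rule dvdE)
    then show ?thesis by (intro exI[of _ "[:u - w * a, w:]"]) (simp add: algebra_simps)
  qed
  then show ?thesis unfolding eq using div by blast
qed


section \<open>Fractional ideals in coordinates\<close>

lemma uminus_K [simp]: "\<ominus>\<^bsub>K\<^esub> elt u v = elt (- u) (- v)"
proof -
  interpret cring K by (rule cring_K)
  show ?thesis by (rule minus_equality) (simp_all add: zero_K)
qed

text \<open>Closure under negation, part of being a subgroup, is the action of \<open>(-1, -1) \<in> R\<close>.\<close>

lemma submodule_iff:
  "submodule I R M \<longleftrightarrow> I \<subseteq> carrier K \<and> elt 0 0 \<in> I \<and>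
     (\<forall>x y x' y'. elt x y \<in> I \<longrightarrow> elt x' y' \<in> I \<longrightarrow> elt (x + x') (y + y') \<in> I) \<and>
     (\<forall>u v x y. m dvd v - u \<longrightarrow> elt x y \<in> I \<longrightarrow> elt (of_int u * x) (of_int v * y) \<in> I)"
  (is "_ \<longleftrightarrow> ?sub \<and> ?zero \<and> ?add \<and> ?smult")
proof -
  interpret cring K by (rule cring_K)
  have M: "subgroup I (add_monoid M) \<longleftrightarrow> subgroup I (add_monoid K)"
    by (simp add: subgroup_def m_inv_def algebra_module_def)
  have "(\<forall>r\<in>carrier R. \<forall>x\<in>I. r \<odot>\<^bsub>M\<^esub> x \<in> I) \<longleftrightarrow>
      (\<forall>e\<in>embed (chi a b) ` carrier R. \<forall>x\<in>I. e \<otimes>\<^bsub>K\<^esub> x \<in> I)"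
    by (simp add: algebra_module_def)
  also have "\<dots> \<longleftrightarrow> ?smult" if sub: ?sub
    using sub unfolding embed_R carrier_K by (auto simp: subset_iff) (metis elt_mult)
  finally have smult: "(\<forall>r\<in>carrier R. \<forall>x\<in>I. r \<odot>\<^bsub>M\<^esub> x \<in> I) \<longleftrightarrow> ?smult" if ?sub
    using that by blast
  have subgroup: "subgroup I (add_monoid K) \<longleftrightarrow> ?zero \<and> ?add" if sub: ?sub and mult: ?smult
  proof
    assume "subgroup I (add_monoid K)"
    then show "?zero \<and> ?add"
      using subgroup.one_closed subgroup.m_closed by (fastforce simp: zero_K)
  next
    assume za: "?zero \<and> ?add"
    show "subgroup I (add_monoid K)"
    proof (rule add.subgroupI)
      fix x assume x: "x \<in> I"
      then obtain u v where uv: "x = elt u v" using sub by (auto simp: carrier_K)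
      have "elt (of_int (- 1) * u) (of_int (- 1) * v) \<in> I"
        using mult x unfolding uv by (metis dvd_0_right diff_self)
      then show "\<ominus>\<^bsub>K\<^esub> x \<in> I" by (simp add: uv)
    next
      fix x x' assume x: "x \<in> I" "x' \<in> I"
      then obtain u v u' v' where "x = elt u v" "x' = elt u' v'" using sub by (force simp: carrier_K)
      then show "x \<oplus>\<^bsub>K\<^esub> x' \<in> I" using za x by simp
    qed (use sub za in auto)
  qed
  have "?sub" if "subgroup I (add_monoid K)"
    using subgroup.subset[OF that] by simp
  then show ?thesis
    unfolding submodule_def submodule_axioms_def M using smult subgroup by blast
qed

lemma
  assumes "fractional_ideal (chi a b) I"
  shows fractional_ideal_subset: "I \<subseteq> carrier K"
    and fractional_ideal_add: "elt x y \<in> I \<Longrightarrow> elt x' y' \<in> I \<Longrightarrow> elt (x + x') (y + y') \<in> I"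
    and fractional_ideal_smult: "m dvd v - u \<Longrightarrow> elt x y \<in> I \<Longrightarrow> elt (of_int u * x) (of_int v * y) \<in> I"
  using assms unfolding fractional_ideal_def submodule_iff by blast+

section \<open>The lattices given by a congruence\<close>

definition std :: "int \<Rightarrow> rat poly set set" where
  "std t = {elt (of_int u) (of_int v) | u v. m dvd v - t * u}"

lemma elt_in_std [simp]: "elt (of_int u) (of_int v) \<in> std t \<longleftrightarrow> m dvd v - t * u"
  by (auto simp: std_def)

lemma std_subset: "std t \<subseteq> carrier K"
  by (auto simp: std_def)

lemma std_cong:
  assumes "[s = t] (mod m)"
  shows "std s = std t"
proof -
  have "m dvd (t - s) * u" for u
    using assms by (simp add: cong_iff_dvd_diff dvd_diff_commute)
  then have "m dvd v - s * u \<longleftrightarrow> m dvd v - t * u" for u v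
  proof -
    have "v - s * u = (t - s) * u + (v - t * u)" by (simp add: algebra_simps)
    then show ?thesis by (simp only: dvd_add_right_iff \<open>m dvd (t - s) * u\<close>)
  qed
  then show ?thesis by (simp add: std_def)
qed

lemma unit_ideal_eq_std: "unit_ideal (chi a b) = std 1"
  by (simp add: unit_ideal_def embed_R std_def)

lemma submodule_std: "submodule (std t) R M"
  unfolding submodule_iff
proof (intro conjI allI impI std_subset)
  show "elt 0 0 \<in> std t" using elt_in_std[of 0 0] by simp
next
  fix x y x' y' assume "elt x y \<in> std t" "elt x' y' \<in> std t"
  then obtain u v u' v' where uv: "x = of_int u" "y = of_int v" "x' = of_int u'" "y' = of_int v'"
      "m dvd v - t * u" "m dvd v' - t * u'"
    by (auto simp: std_def)
  have "m dvd (v - t * u) + (v' - t * u')" using uv by (intro dvd_add)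
  then have "m dvd (v + v') - t * (u + u')" by (simp add: algebra_simps)
  then show "elt (x + x') (y + y') \<in> std t" using uv elt_in_std[of "u + u'" "v + v'"] by simp
next
  fix r s x y assume rs: "m dvd s - r" and "elt x y \<in> std t"
  then obtain u v where uv: "x = of_int u" "y = of_int v" "m dvd v - t * u"
    by (auto simp: std_def)
  have "m dvd (s - r) * v + r * (v - t * u)" using uv rs by (intro dvd_add dvd_mult dvd_mult2)
  then have "m dvd s * v - t * (r * u)" by (simp add: algebra_simps)
  then show "elt (of_int r * x) (of_int s * y) \<in> std t" using uv elt_in_std[of "r * u" "s * v"] by simp
qed

text \<open>A basis is \<open>(1, t)\<close>, \<open>(0, m)\<close>.\<close>

lemma std_free: "(add_monoid K)\<lparr>carrier := std t\<rparr> \<cong> free_Abelian_group {..<2::nat}"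
proof -
  let ?g = "\<lambda>c. elt (of_int (Poly_Mapping.lookup c (0::nat)))
    (of_int (t * Poly_Mapping.lookup c 0 + m * Poly_Mapping.lookup c 1))"
  have "?g \<in> iso (free_Abelian_group {..<2}) ((add_monoid K)\<lparr>carrier := std t\<rparr>)"
    unfolding iso_def bij_betw_def
  proof (intro CollectI conjI)
    have "?g c \<in> std t" for c unfolding elt_in_std by simp
    then show "?g \<in> hom (free_Abelian_group {..<2}) ((add_monoid K)\<lparr>carrier := std t\<rparr>)"
      by (intro homI) (simp_all add: lookup_add algebra_simps)
    show "inj_on ?g (carrier (free_Abelian_group {..<2}))"
    proof (rule inj_onI)
      fix c d
      assume keys: "c \<in> carrier (free_Abelian_group {..<2::nat})" "d \<in> carrier (free_Abelian_group {..<2::nat})"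
        and g: "?g c = ?g d"
      have eq0: "Poly_Mapping.lookup c 0 = Poly_Mapping.lookup d 0"
        using g unfolding elt_eq_iff of_int_eq_iff by (rule conjunct1)
      have "t * Poly_Mapping.lookup c 0 + m * Poly_Mapping.lookup c 1 =
            t * Poly_Mapping.lookup d 0 + m * Poly_Mapping.lookup d 1"
        using g unfolding elt_eq_iff of_int_eq_iff by (rule conjunct2)
      then have eq1: "Poly_Mapping.lookup c 1 = Poly_Mapping.lookup d 1"
        using a_less_b by (simp add: eq0)
      show "c = d"
      proof (rule poly_mapping_eqI)
        fix k :: nat
        consider "k = 0" | "k = 1" | "k \<ge> 2" by linarith
        then show "Poly_Mapping.lookup c k = Poly_Mapping.lookup d k"
        proof cases
          case 3
          then have "k \<notin> Poly_Mapping.keys c" "k \<notin> Poly_Mapping.keys d" using keys by auto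
          then show ?thesis by (simp add: in_keys_iff)
        qed (simp_all only: eq0 eq1)
      qed
    qed
    show "?g ` carrier (free_Abelian_group {..<2}) = carrier ((add_monoid K)\<lparr>carrier := std t\<rparr>)"
    proof (intro equalityI subsetI)
      fix z assume "z \<in> carrier ((add_monoid K)\<lparr>carrier := std t\<rparr>)"
      then obtain u v where z: "z = elt (of_int u) (of_int v)" "m dvd v - t * u" by (auto simp: std_def)
      then obtain w where w: "v = t * u + m * w" by (metis dvdE diff_add_cancel add.commute)
      let ?c = "frag_cmul u (frag_of (0::nat)) + frag_cmul w (frag_of 1)"
      have "Poly_Mapping.keys ?c \<subseteq> {..<2}"
        by (rule order_trans[OF Poly_Mapping.keys_add]) (auto simp: keys_frag_of)
      moreover have "?g ?c = z" by (simp add: z w lookup_add lookup_one)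
      ultimately show "z \<in> ?g ` carrier (free_Abelian_group {..<2})" by force
    qed (use \<open>\<And>c. ?g c \<in> std t\<close> in auto)
  qed
  then show ?thesis
    using group.iso_sym[OF group_free_Abelian_group] is_isoI by blast
qed

lemma fractional_std: "fractional_ideal (chi a b) (std t)"
  unfolding fractional_ideal_def by (intro conjI submodule_std std_free)

text \<open>An induction principle that replaces both the elements of \<open>K\<close> and the property to be proved
  by their coordinates.\<close>

lemma ideal_prod_elt_induct:
  assumes "I \<subseteq> carrier K" "J \<subseteq> carrier K" and z: "z \<in> ideal_prod K I J"
    and prod: "\<And>x y x' y'. elt x y \<in> I \<Longrightarrow> elt x' y' \<in> J \<Longrightarrow> P (x * x') (y * y')"
    and sum: "\<And>x y x' y'. P x y \<Longrightarrow> P x' y' \<Longrightarrow> P (x + x') (y + y')"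
  shows "\<exists>x y. z = elt x y \<and> P x y"
  using z
proof induction
  case (prod i j)
  then obtain x y x' y' where "i = elt x y" "j = elt x' y'" using assms(1,2) by (force simp: carrier_K)
  then show ?case using prod assms(4) by auto
next
  case (sum s1 s2)
  then show ?case using assms(5) by fastforce
qed

lemma ideal_prod_elt: "elt x y \<in> I \<Longrightarrow> elt x' y' \<in> J \<Longrightarrow> elt (x * x') (y * y') \<in> ideal_prod K I J"
  by (metis ideal_prod.prod elt_mult)

text \<open>For the inclusion from right to left, an element \<open>(u, t s u + m w)\<close> splits into
  \<open>(u, t u) (1, s)\<close> and \<open>(0, m w) (r, 1)\<close>. The factor \<open>(r, 1)\<close> lies in \<open>std s\<close> exactly when
  \<open>s r \<equiv> 1\<close>, which is where \<open>s\<close> has to be a unit modulo \<open>m\<close>.\<close>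

lemma ideal_prod_std:
  assumes "coprime s m"
  shows "ideal_prod K (std t) (std s) = std (t * s)"
proof (intro equalityI subsetI)
  fix z assume z: "z \<in> ideal_prod K (std t) (std s)"
  have "\<exists>x y. z = elt x y \<and> elt x y \<in> std (t * s)"
  proof (rule ideal_prod_elt_induct[OF std_subset std_subset z])
    fix x y x' y' assume "elt x y \<in> std t" "elt x' y' \<in> std s"
    then obtain u v u' v' where uv: "x = of_int u" "y = of_int v" "x' = of_int u'" "y' = of_int v'"
        "m dvd v - t * u" "m dvd v' - s * u'"
      by (auto simp: std_def)
    have "m dvd (v - t * u) * v' + t * u * (v' - s * u')" using uv by (intro dvd_add dvd_mult dvd_mult2)
    then have "m dvd v * v' - t * s * (u * u')" by (simp add: algebra_simps)
    then show "elt (x * x') (y * y') \<in> std (t * s)" using uv elt_in_std[of "u * u'" "v * v'"] by simp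
  qed (rule fractional_ideal_add[OF fractional_std])
  then show "z \<in> std (t * s)" by auto
next
  fix z assume "z \<in> std (t * s)"
  then obtain u v where z: "z = elt (of_int u) (of_int v)" "m dvd v - t * s * u" by (auto simp: std_def)
  then obtain w where w: "v = t * s * u + m * w" by (metis dvdE diff_add_cancel add.commute)
  obtain r where "[s * r = 1] (mod m)" using assms cong_solve_coprime_int by blast
  then have r: "m dvd 1 - s * r" by (simp add: cong_iff_dvd_diff dvd_diff_commute)
  have "elt (of_int u * of_int 1) (of_int (t * u) * of_int s) \<oplus>\<^bsub>K\<^esub> elt (of_int 0 * of_int r) (of_int (m * w) * of_int 1)
      \<in> ideal_prod K (std t) (std s)"
    by (intro ideal_prod.sum ideal_prod_elt; unfold elt_in_std) (use r in simp_all)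
  then show "z \<in> ideal_prod K (std t) (std s)" by (simp add: z w algebra_simps)
qed

section \<open>Equivalence of fractional ideals\<close>

lemma l_coset_eq_iff:
  assumes "I \<subseteq> carrier K" "J \<subseteq> carrier K" "p \<noteq> 0" "q \<noteq> 0"
  shows "I = elt p q <#\<^bsub>K\<^esub> J \<longleftrightarrow> (\<forall>x y. elt (p * x) (q * y) \<in> I \<longleftrightarrow> elt x y \<in> J)"
proof -
  have "elt x y \<in> elt p q <#\<^bsub>K\<^esub> J \<longleftrightarrow> elt (x / p) (y / q) \<in> J" for x y
  proof -
    have "elt x y \<in> elt p q <#\<^bsub>K\<^esub> J \<longleftrightarrow> (\<exists>x' y'. elt x' y' \<in> J \<and> x = p * x' \<and> y = q * y')"
      using assms(2) by (force simp: l_coset_def carrier_K)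
    also have "\<dots> \<longleftrightarrow> elt (x / p) (y / q) \<in> J"
    proof
      assume "elt (x / p) (y / q) \<in> J"
      then show "\<exists>x' y'. elt x' y' \<in> J \<and> x = p * x' \<and> y = q * y'"
        using assms(3,4) by - (rule exI[where x = "x / p"], rule exI[where x = "y / q"], simp)
    qed (use assms(3,4) in auto)
    finally show ?thesis .
  qed
  note scaled = this
  have sub: "elt p q <#\<^bsub>K\<^esub> J \<subseteq> carrier K"
    using assms(2) by (force simp: l_coset_def carrier_K)
  show ?thesis
  proof
    assume "I = elt p q <#\<^bsub>K\<^esub> J"
    then show "\<forall>x y. elt (p * x) (q * y) \<in> I \<longleftrightarrow> elt x y \<in> J"
      using assms(3,4) by (simp add: scaled)
  next
    assume eq: "\<forall>x y. elt (p * x) (q * y) \<in> I \<longleftrightarrow> elt x y \<in> J"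
    have "elt x y \<in> I \<longleftrightarrow> elt x y \<in> elt p q <#\<^bsub>K\<^esub> J" for x y
      using eq[rule_format, of "x / p" "y / q"] assms(3,4) by (simp add: scaled)
    then have "z \<in> I \<longleftrightarrow> z \<in> elt p q <#\<^bsub>K\<^esub> J" if "z \<in> carrier K" for z
      using that unfolding carrier_K by blast
    then show "I = elt p q <#\<^bsub>K\<^esub> J"
      using assms(1) sub by blast
  qed
qed

lemma ideal_equiv_iff:
  "(I, J) \<in> ideal_equiv (chi a b) \<longleftrightarrow> fractional_ideal (chi a b) I \<and> fractional_ideal (chi a b) J \<and>
     (\<exists>p q. p \<noteq> 0 \<and> q \<noteq> 0 \<and> (\<forall>x y. elt (p * x) (q * y) \<in> I \<longleftrightarrow> elt x y \<in> J))"
proof -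
  have "(\<exists>k\<in>Units K. I = k <#\<^bsub>K\<^esub> J) \<longleftrightarrow>
      (\<exists>p q. p \<noteq> 0 \<and> q \<noteq> 0 \<and> (\<forall>x y. elt (p * x) (q * y) \<in> I \<longleftrightarrow> elt x y \<in> J))"
    if "fractional_ideal (chi a b) I" "fractional_ideal (chi a b) J"
    using l_coset_eq_iff[OF that[THEN fractional_ideal_subset]] by (auto simp: Units_K) blast+
  then show ?thesis unfolding ideal_equiv_def by blast
qed

lemma equiv_ideal_equiv: "equiv {I. fractional_ideal (chi a b) I} (ideal_equiv (chi a b))"
proof (rule equivI)
  show "ideal_equiv (chi a b) \<subseteq> {I. fractional_ideal (chi a b) I} \<times> {I. fractional_ideal (chi a b) I}"
    unfolding ideal_equiv_def by blast
  show "refl_on {I. fractional_ideal (chi a b) I} (ideal_equiv (chi a b))"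
  proof (rule refl_onI)
    fix I assume "I \<in> {I. fractional_ideal (chi a b) I}"
    then show "(I, I) \<in> ideal_equiv (chi a b)"
      unfolding ideal_equiv_iff by (intro conjI exI[of _ 1]) simp_all
  qed
  show "sym (ideal_equiv (chi a b))"
  proof (rule symI)
    fix I J assume IJ: "(I, J) \<in> ideal_equiv (chi a b)"
    then obtain p q where pq: "p \<noteq> 0" "q \<noteq> 0" "\<forall>x y. elt (p * x) (q * y) \<in> I \<longleftrightarrow> elt x y \<in> J"
      unfolding ideal_equiv_iff by blast
    have "elt (1 / p * x) (1 / q * y) \<in> J \<longleftrightarrow> elt x y \<in> I" for x y
      using pq(1,2) pq(3)[rule_format, of "x / p" "y / q"] by simp
    then show "(J, I) \<in> ideal_equiv (chi a b)"
      using IJ pq(1,2) unfolding ideal_equiv_iff by (metis divide_eq_0_iff one_neq_zero)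
  qed
  show "trans (ideal_equiv (chi a b))"
  proof (rule transI)
    fix I J L assume IJ: "(I, J) \<in> ideal_equiv (chi a b)" and JL: "(J, L) \<in> ideal_equiv (chi a b)"
    obtain p q where pq: "p \<noteq> 0" "q \<noteq> 0" "\<forall>x y. elt (p * x) (q * y) \<in> I \<longleftrightarrow> elt x y \<in> J"
      using IJ unfolding ideal_equiv_iff by blast
    obtain p' q' where pq': "p' \<noteq> 0" "q' \<noteq> 0" "\<forall>x y. elt (p' * x) (q' * y) \<in> J \<longleftrightarrow> elt x y \<in> L"
      using JL unfolding ideal_equiv_iff by blast
    have "\<forall>x y. elt ((p * p') * x) ((q * q') * y) \<in> I \<longleftrightarrow> elt x y \<in> L"
      using pq(3) pq'(3) by (simp add: mult.assoc)
    moreover have "p * p' \<noteq> 0" "q * q' \<noteq> 0" using pq pq' by auto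
    ultimately show "(I, L) \<in> ideal_equiv (chi a b)"
      using IJ JL unfolding ideal_equiv_iff by blast
  qed
qed

lemma ideal_prod_scaled:
  assumes sub: "I \<subseteq> carrier K" "J \<subseteq> carrier K"
    and I: "\<And>x y. elt x y \<in> I \<Longrightarrow> elt (p * x) (q * y) \<in> I'"
    and J: "\<And>x y. elt x y \<in> J \<Longrightarrow> elt (p' * x) (q' * y) \<in> J'"
    and "elt x y \<in> ideal_prod K I J"
  shows "elt (p * p' * x) (q * q' * y) \<in> ideal_prod K I' J'"
proof -
  have "\<exists>x' y'. elt x y = elt x' y' \<and> elt (p * p' * x') (q * q' * y') \<in> ideal_prod K I' J'"
  proof (rule ideal_prod_elt_induct[OF sub assms(5),
        where P = "\<lambda>x y. elt (p * p' * x) (q * q' * y) \<in> ideal_prod K I' J'"])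
    fix x y x' y' assume "elt x y \<in> I" "elt x' y' \<in> J"
    then have "elt ((p * x) * (p' * x')) ((q * y) * (q' * y')) \<in> ideal_prod K I' J'"
      by (intro ideal_prod_elt I J)
    then show "elt (p * p' * (x * x')) (q * q' * (y * y')) \<in> ideal_prod K I' J'"
      by (simp add: mult_ac)
  next
    fix x y x' y'
    assume "elt (p * p' * x) (q * q' * y) \<in> ideal_prod K I' J'" "elt (p * p' * x') (q * q' * y') \<in> ideal_prod K I' J'"
    from ideal_prod.sum[OF this]
    show "elt (p * p' * (x + x')) (q * q' * (y + y')) \<in> ideal_prod K I' J'"
      by (simp add: distrib_left)
  qed
  then show ?thesis by simp
qed

text \<open>Multiplication of classes is independent of the representatives. Both products are assumed to
  be fractional ideals, since the equivalence relates nothing else.\<close>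

lemma ideal_prod_equiv:
  assumes "(I, I') \<in> ideal_equiv (chi a b)" "(J, J') \<in> ideal_equiv (chi a b)"
    and "fractional_ideal (chi a b) (ideal_prod K I J)" "fractional_ideal (chi a b) (ideal_prod K I' J')"
  shows "(ideal_prod K I J, ideal_prod K I' J') \<in> ideal_equiv (chi a b)"
proof -
  obtain p q where pq: "p \<noteq> 0" "q \<noteq> 0" "\<And>x y. elt (p * x) (q * y) \<in> I \<longleftrightarrow> elt x y \<in> I'"
    using assms(1) unfolding ideal_equiv_iff by blast
  obtain p' q' where pq': "p' \<noteq> 0" "q' \<noteq> 0" "\<And>x y. elt (p' * x) (q' * y) \<in> J \<longleftrightarrow> elt x y \<in> J'"
    using assms(2) unfolding ideal_equiv_iff by blast
  have sub: "I \<subseteq> carrier K" "J \<subseteq> carrier K" "I' \<subseteq> carrier K" "J' \<subseteq> carrier K"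
    using assms(1,2) unfolding ideal_equiv_iff by (simp_all add: fractional_ideal_subset)
  have inv: "elt (1 / p * x) (1 / q * y) \<in> I'" if "elt x y \<in> I" for x y
    using that pq(1,2) pq(3)[of "x / p" "y / q"] by simp
  have inv': "elt (1 / p' * x) (1 / q' * y) \<in> J'" if "elt x y \<in> J" for x y
    using that pq'(1,2) pq'(3)[of "x / p'" "y / q'"] by simp
  have "elt (p * p' * x) (q * q' * y) \<in> ideal_prod K I J \<longleftrightarrow> elt x y \<in> ideal_prod K I' J'" for x y
  proof
    assume "elt x y \<in> ideal_prod K I' J'"
    then show "elt (p * p' * x) (q * q' * y) \<in> ideal_prod K I J"
      by - (rule ideal_prod_scaled[where I = I' and J = J' and p = p and q = q and p' = p' and q' = q'];
        (rule sub | simp only: pq(3) pq'(3)))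
  next
    assume "elt (p * p' * x) (q * q' * y) \<in> ideal_prod K I J"
    then have "elt ((1 / p) * (1 / p') * (p * p' * x)) ((1 / q) * (1 / q') * (q * q' * y)) \<in> ideal_prod K I' J'"
      by - (rule ideal_prod_scaled[where I = I and J = J]; (rule sub | erule inv inv' | assumption))
    then show "elt x y \<in> ideal_prod K I' J'" using pq(1,2) pq'(1,2) by simp
  qed
  moreover have "p * p' \<noteq> 0" "q * q' \<noteq> 0" using pq pq' by auto
  ultimately show ?thesis using assms(3,4) unfolding ideal_equiv_iff by blast
qed

section \<open>Invertible ideals\<close>

text \<open>Since \<open>1 \<in> I J\<close> has nonzero coordinate \<open>f\<close>, so do some \<open>i \<in> I\<close> and \<open>j \<in> J\<close>; and \<open>I J \<subseteq> R\<close>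
  makes the coordinate of \<open>j\<close> a common denominator for that coordinate on \<open>I\<close>.\<close>

lemma projection_cyclic:
  assumes I: "fractional_ideal (chi a b) I" and J: "fractional_ideal (chi a b) J"
    and IJ: "ideal_prod K I J = unit_ideal (chi a b)"
    and f: "f = (\<lambda>x y. x) \<or> f = (\<lambda>x y. y)"
  obtains c where "c \<noteq> 0" "{f x y | x y. elt x y \<in> I} = range (\<lambda>n. of_int n * c)"
proof -
  have f_hom: "f (x + x') (y + y') = f x y + f x' y'" "f (x * x') (y * y') = f x y * f x' y'"
    "f 1 1 = 1" for x y x' y'
    using f by auto
  have "\<exists>x y x' y'. elt x y \<in> I \<and> elt x' y' \<in> J \<and> f x y * f x' y' \<noteq> 0"
  proof (rule ccontr)
    assume zero: "\<not> ?thesis"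
    have "elt 1 1 \<in> ideal_prod K I J"
      using elt_in_std[of 1 1 1] by (simp add: IJ unit_ideal_eq_std)
    then have "\<exists>x y. elt 1 1 = elt x y \<and> f x y = 0"
    proof (rule ideal_prod_elt_induct[OF I[THEN fractional_ideal_subset] J[THEN fractional_ideal_subset],
          where P = "\<lambda>x y. f x y = 0"])
      show "f (x * x') (y * y') = 0" if "elt x y \<in> I" "elt x' y' \<in> J" for x y x' y'
        using zero that f_hom(2) by metis
    qed (simp add: f_hom(1))
    then show False using f_hom(3) by auto
  qed
  then obtain x0 y0 r s where nz: "elt x0 y0 \<in> I" "elt r s \<in> J" "f x0 y0 * f r s \<noteq> 0" by blast
  show ?thesis
  proof (rule cyclic_if_scaled_into_Ints[of "{f x y | x y. elt x y \<in> I}" "f r s" "f x0 y0"])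
    fix u v assume "u \<in> {f x y | x y. elt x y \<in> I}" "v \<in> {f x y | x y. elt x y \<in> I}"
    then obtain x y x' y' where "u = f x y" "elt x y \<in> I" "v = f x' y'" "elt x' y' \<in> I" by blast
    then have "u + v = f (x + x') (y + y')" "elt (x + x') (y + y') \<in> I"
      using fractional_ideal_add[OF I] by (simp_all add: f_hom(1))
    then show "u + v \<in> {f x y | x y. elt x y \<in> I}" by blast
  next
    fix n u assume "u \<in> {f x y | x y. elt x y \<in> I}"
    then obtain x y where xy: "u = f x y" "elt x y \<in> I" by blast
    then have "elt (of_int n * x) (of_int n * y) \<in> I"
      by (intro fractional_ideal_smult[OF I]) simp_all
    moreover have "of_int n * u = f (of_int n * x) (of_int n * y)" using xy f by auto
    ultimately show "of_int n * u \<in> {f x y | x y. elt x y \<in> I}" by blast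
  next
    fix u assume "u \<in> {f x y | x y. elt x y \<in> I}"
    then obtain x y where xy: "u = f x y" "elt x y \<in> I" by blast
    then have "elt (x * r) (y * s) \<in> std 1"
      unfolding unit_ideal_eq_std[symmetric] IJ[symmetric] by (intro ideal_prod_elt nz(2))
    then have "x * r \<in> \<int>" "y * s \<in> \<int>" by (auto simp: std_def)
    then show "u * f r s \<in> \<int>" using xy f by auto
  next
    show "f x0 y0 \<in> {f x y | x y. elt x y \<in> I}" using nz(1) by blast
  qed (use nz that in simp_all)
qed

text \<open>Here \<open>c\<close> and \<open>d\<close> generate the two projections of \<open>I\<close>, so that \<open>(c, d)\<close> is the factor taking
  \<open>std t\<close> to \<open>I\<close>. In the normalization by this factor, \<open>t\<close> comes from an element \<open>(1, t)\<close> of \<open>I\<close>, and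
  its inverse \<open>k\<close> from an element \<open>(1, k)\<close> of \<open>J\<close>.\<close>

lemma invertible_ideal_scaled_std:
  assumes I: "fractional_ideal (chi a b) I" and J: "fractional_ideal (chi a b) J"
    and IJ: "ideal_prod K I J = unit_ideal (chi a b)"
  obtains t where "coprime t m" "(I, std t) \<in> ideal_equiv (chi a b)"
proof -
  obtain c where c: "c \<noteq> 0" "{x | x y. elt x y \<in> I} = range (\<lambda>n. of_int n * c)"
    by (rule projection_cyclic[OF I J IJ, of "\<lambda>x y. x"]) auto
  obtain d where d: "d \<noteq> 0" "{y | x y. elt x y \<in> I} = range (\<lambda>n. of_int n * d)"
    by (rule projection_cyclic[OF I J IJ, of "\<lambda>x y. y"]) auto
  have coords: "\<exists>u v. x = of_int u * c \<and> y = of_int v * d" if "elt x y \<in> I" for x y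
  proof -
    have "x \<in> range (\<lambda>n. of_int n * c)" "y \<in> range (\<lambda>n. of_int n * d)"
      using that by (auto simp flip: c(2) d(2))
    then show ?thesis by blast
  qed
  have "c \<in> {x | x y. elt x y \<in> I}" unfolding c(2) by (rule range_eqI[of _ _ 1]) simp
  then obtain t where t: "elt c (of_int t * d) \<in> I" using coords by blast
  have "d \<in> {y | x y. elt x y \<in> I}" unfolding d(2) by (rule range_eqI[of _ _ 1]) simp
  then obtain u0 where u0: "elt (of_int u0 * c) d \<in> I" using coords by blast
  \<comment> \<open>The first projection of \<open>J\<close> contains \<open>1 / c\<close>: it contains \<open>x / c\<close> for the first coordinate
    \<open>x\<close> of every element of \<open>I J\<close>, in particular of \<open>1\<close>.\<close>
  have "elt 1 1 \<in> ideal_prod K I J"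
    using elt_in_std[of 1 1 1] by (simp add: IJ unit_ideal_eq_std)
  then have "\<exists>x y. elt 1 1 = elt x y \<and> (\<exists>s. elt (x / c) s \<in> J)"
  proof (rule ideal_prod_elt_induct[OF I[THEN fractional_ideal_subset] J[THEN fractional_ideal_subset],
        where P = "\<lambda>x y. \<exists>s. elt (x / c) s \<in> J"])
    fix x y x' y' assume "elt x y \<in> I" and J': "elt x' y' \<in> J"
    then obtain n where "x = of_int n * c" using coords by blast
    then have "x * x' / c = of_int n * x'" using c(1) by simp
    then show "\<exists>s. elt (x * x' / c) s \<in> J"
      using fractional_ideal_smult[OF J _ J', of n n] by auto
  next
    fix x x' assume "\<exists>s. elt (x / c) s \<in> J" "\<exists>s. elt (x' / c) s \<in> J"
    then show "\<exists>s. elt ((x + x') / c) s \<in> J"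
      unfolding add_divide_distrib using fractional_ideal_add[OF J] by blast
  qed
  then obtain s where s: "elt (1 / c) s \<in> J" by auto
  have pairing: "elt (of_int u) (of_int v * (d * s)) \<in> std 1" if "elt (of_int u * c) (of_int v * d) \<in> I" for u v
    using ideal_prod_elt[OF that s] c(1) by (simp add: IJ unit_ideal_eq_std mult.assoc)
  have "elt (of_int u0) (of_int 1 * (d * s)) \<in> std 1"
    by (rule pairing) (use u0 in simp)
  then obtain k where k: "d * s = of_int k" by (auto simp: std_def)
  have pairing': "m dvd v * k - u" if "elt (of_int u * c) (of_int v * d) \<in> I" for u v
    using pairing[OF that] elt_in_std[of u "v * k" 1] by (simp add: k)
  have tk: "m dvd t * k - 1" by (rule pairing') (use t in simp)
  have "coprime t m"
    using tk by (metis cong_iff_dvd_diff coprime_iff_invertible_int)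
  moreover have "elt (c * x) (d * y) \<in> I \<longleftrightarrow> elt x y \<in> std t" for x y
  proof
    assume xy: "elt (c * x) (d * y) \<in> I"
    then obtain u v where uv: "c * x = of_int u * c" "d * y = of_int v * d" using coords by blast
    then have "x = of_int u" "y = of_int v" using c(1) d(1) by simp_all
    moreover have "m dvd t * (v * k - u) - v * (t * k - 1)"
      by (rule dvd_diff[OF dvd_mult[OF pairing'[OF xy[unfolded uv]]] dvd_mult[OF tk]])
    then have "m dvd v - t * u" by (simp add: algebra_simps)
    ultimately show "elt x y \<in> std t" by simp
  next
    assume "elt x y \<in> std t"
    then obtain u v where uv: "x = of_int u" "y = of_int v" "m dvd v - t * u" by (auto simp: std_def)
    then obtain w where w: "v = t * u + m * w" by (metis dvdE diff_add_cancel add.commute)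
    have "elt (of_int u * c + of_int 0 * (of_int u0 * c)) (of_int u * (of_int t * d) + of_int (m * w) * d) \<in> I"
      by (intro fractional_ideal_add[OF I] fractional_ideal_smult[OF I] t u0) simp_all
    then show "elt (c * x) (d * y) \<in> I" by (simp add: uv w algebra_simps)
  qed
  ultimately show ?thesis
    using that I fractional_std c(1) d(1) unfolding ideal_equiv_iff by blast
qed

section \<open>The class group\<close>

text \<open>The factor \<open>(p, q)\<close> maps \<open>std t\<close> onto \<open>std s\<close>, and both lattices have projections \<open>\<int>\<close>. That the
  second projection is all of \<open>\<int>\<close> needs \<open>t\<close> and \<open>s\<close> to be units: \<open>(t', 1) \<in> std t\<close> for an
  inverse \<open>t'\<close> of \<open>t\<close>. Hence \<open>p\<close>, \<open>q\<close> and their inverses are integers.\<close>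

lemma std_equiv_imp_cong:
  assumes s: "coprime s m" and t: "coprime t m" and equiv: "(std s, std t) \<in> ideal_equiv (chi a b)"
  shows "[s = t] (mod m) \<or> [s = - t] (mod m)"
proof -
  obtain p q where pq: "p \<noteq> 0" "q \<noteq> 0" "\<And>x y. elt (p * x) (q * y) \<in> std s \<longleftrightarrow> elt x y \<in> std t"
    using equiv unfolding ideal_equiv_iff by blast
  obtain s' where s': "m dvd 1 - s * s'"
    using s by (metis cong_solve_coprime_int cong_iff_dvd_diff dvd_diff_commute)
  obtain t' where t': "m dvd 1 - t * t'"
    using t by (metis cong_solve_coprime_int cong_iff_dvd_diff dvd_diff_commute)
  have "elt (p * of_int 1) (q * of_int t) \<in> std s" "elt (p * of_int t') (q * of_int 1) \<in> std s"
    unfolding pq(3) elt_in_std using t' by simp_all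
  note integral = this
  then obtain u v where u: "p = of_int u" and v: "q = of_int v" by (auto simp: std_def)
  then have dvd: "m dvd v * t - s * u"
    using integral(1) elt_in_std[of u "v * t" s] by simp
  have "elt (p * (1 / p)) (q * (of_int s / q)) \<in> std s" "elt (p * (of_int s' / p)) (q * (1 / q)) \<in> std s"
    using elt_in_std[of 1 s s] elt_in_std[of s' 1 s] pq(1,2) s' by simp_all
  then obtain u' v' where u': "1 / p = of_int u'" and v': "1 / q = of_int v'"
    unfolding pq(3) by (auto simp: std_def)
  have "of_int (u * u') = (1 :: rat)" "of_int (v * v') = (1 :: rat)"
    using u v u' v' pq(1,2) by (simp_all flip: u v u' v')
  then have "u * u' = 1" "v * v' = 1" by (simp_all only: of_int_eq_1_iff)
  then have "u = 1 \<or> u = - 1" "v = 1 \<or> v = - 1" using zmult_eq_1_iff by blast+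
  then have "m dvd t - s \<or> m dvd - t - s \<or> m dvd t + s \<or> m dvd - t + s"
    using dvd by auto
  moreover have "m dvd - t - s \<longleftrightarrow> m dvd s - (- t)" "m dvd - t + s \<longleftrightarrow> m dvd s - t"
      "m dvd t - s \<longleftrightarrow> m dvd s - t" "m dvd t + s \<longleftrightarrow> m dvd s - (- t)"
    using dvd_minus_iff[of m "- t - s"] dvd_diff_commute[of m] by (simp_all add: add.commute)
  ultimately show ?thesis unfolding cong_iff_dvd_diff by blast
qed

lemma std_minus_equiv: "(std (- t), std t) \<in> ideal_equiv (chi a b)"
proof -
  have "elt x (- y) \<in> std (- t)" if xy: "elt x y \<in> std t" for x y t
  proof -
    from xy obtain u v where uv: "x = of_int u" "y = of_int v" "m dvd v - t * u" by (auto simp: std_def)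
    then have "m dvd - v - (- t) * u"
      using dvd_minus_iff[of m "v - t * u"] by (simp add: algebra_simps)
    then show ?thesis using uv elt_in_std[of u "- v" "- t"] by simp
  qed
  from this[of _ _ t] this[of _ _ "- t"]
  have "elt (1 * x) (- 1 * y) \<in> std (- t) \<longleftrightarrow> elt x y \<in> std t" for x y
    by fastforce
  then show ?thesis
    unfolding ideal_equiv_iff by (intro conjI fractional_std exI[of _ 1] exI[of _ "- 1"]) auto
qed

definition std_class :: "int \<Rightarrow> rat poly set set set" where
  "std_class t = ideal_equiv (chi a b) `` {std t}"

lemma std_class_eq_iff:
  assumes "coprime s m" "coprime t m"
  shows "std_class s = std_class t \<longleftrightarrow> [s = t] (mod m) \<or> [s = - t] (mod m)"
proof -
  have "std_class s = std_class t \<longleftrightarrow> (std s, std t) \<in> ideal_equiv (chi a b)"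
    unfolding std_class_def by (rule eq_equiv_class_iff[OF equiv_ideal_equiv]) (simp_all add: fractional_std)
  also have "\<dots> \<longleftrightarrow> [s = t] (mod m) \<or> [s = - t] (mod m)"
  proof
    assume "[s = t] (mod m) \<or> [s = - t] (mod m)"
    then have "std s = std t \<or> std s = std (- t)" using std_cong by blast
    moreover have "(std t, std t) \<in> ideal_equiv (chi a b)"
      using equiv_ideal_equiv fractional_std by (simp add: equiv_def refl_on_def)
    ultimately show "(std s, std t) \<in> ideal_equiv (chi a b)" using std_minus_equiv by auto
  qed (rule std_equiv_imp_cong[OF assms])
  finally show ?thesis .
qed

text \<open>In the union that defines the product of classes, representatives whose product is not a
  fractional ideal contribute the empty set, and all others contribute the class of
  \<open>std t \<cdot> std s\<close>.\<close>

lemma std_class_mult: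
  assumes "coprime s m"
  shows "std_class t \<otimes>\<^bsub>ICM (chi a b)\<^esub> std_class s = std_class (t * s)"
proof -
  let ?E = "ideal_equiv (chi a b)"
  have "?E `` {ideal_prod K I J} \<subseteq> std_class (t * s)"
    if I: "(std t, I) \<in> ?E" and J: "(std s, J) \<in> ?E" for I J
  proof
    fix L assume L: "L \<in> ?E `` {ideal_prod K I J}"
    then have "fractional_ideal (chi a b) (ideal_prod K I J)" by (simp add: ideal_equiv_iff)
    then have "(std (t * s), ideal_prod K I J) \<in> ?E"
      using ideal_prod_equiv[OF I J] by (simp add: ideal_prod_std[OF assms] fractional_std)
    then show "L \<in> std_class (t * s)"
      using L equiv_ideal_equiv unfolding std_class_def equiv_def by (auto dest: transD)
  qed
  moreover have "(std x, std x) \<in> ?E" for x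
    using equiv_ideal_equiv fractional_std by (simp add: equiv_def refl_on_def)
  then have "std t \<in> std_class t" "std s \<in> std_class s" by (simp_all add: std_class_def)
  moreover have "?E `` {ideal_prod K (std t) (std s)} = std_class (t * s)"
    by (simp add: std_class_def ideal_prod_std[OF assms])
  moreover have "std_class t \<otimes>\<^bsub>ICM (chi a b)\<^esub> std_class s =
      (\<Union>I\<in>std_class t. \<Union>J\<in>std_class s. ?E `` {ideal_prod K I J})"
    by (simp add: ICM_def)
  ultimately show ?thesis unfolding std_class_def by blast
qed

lemma invertible_std:
  assumes "coprime t m"
  shows "invertible_ideal (chi a b) (std t)"
proof -
  obtain s where s: "[t * s = 1] (mod m)" using assms cong_solve_coprime_int by blast
  then have "coprime s m" by (metis coprime_iff_invertible_int mult.commute)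
  then have "ideal_prod K (std t) (std s) = unit_ideal (chi a b)"
    using std_cong[OF s] by (simp add: ideal_prod_std unit_ideal_eq_std)
  then show ?thesis unfolding invertible_ideal_def using fractional_std by blast
qed

lemma carrier_class_group: "carrier (class_group (chi a b)) = std_class ` {t. coprime t m}"
proof (intro equalityI subsetI)
  fix A assume "A \<in> carrier (class_group (chi a b))"
  then obtain I where I: "invertible_ideal (chi a b) I" "A = ideal_equiv (chi a b) `` {I}"
    by (auto simp: class_group_def elim: quotientE)
  then obtain t where t: "coprime t m" "(I, std t) \<in> ideal_equiv (chi a b)"
    unfolding invertible_ideal_def by (metis invertible_ideal_scaled_std)
  then have "A = std_class t"
    unfolding I(2) std_class_def by (intro equiv_class_eq[OF equiv_ideal_equiv])
  then show "A \<in> std_class ` {t. coprime t m}" using t by blast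
next
  fix A assume "A \<in> std_class ` {t. coprime t m}"
  then show "A \<in> carrier (class_group (chi a b))"
    by (auto simp: class_group_def std_class_def intro!: quotientI invertible_std)
qed

lemma one_class_group: "\<one>\<^bsub>class_group (chi a b)\<^esub> = std_class 1"
  by (simp add: class_group_def ICM_def std_class_def unit_ideal_eq_std)

lemma mult_class_group: "monoid.mult (class_group (chi a b)) = monoid.mult (ICM (chi a b))"
  by (simp add: class_group_def)

lemma trivial_class_group:
  assumes "m \<le> 2"
  shows "trivial_group (class_group (chi a b))"
proof -
  have "[t = 1] (mod m)" if "coprime t m" for t
  proof -
    consider "m = 1" | "m = 2" using assms a_less_b by linarith
    then show ?thesis
    proof cases
      case 2
      then have "odd t" using that by simp
      then show ?thesis unfolding 2 by (simp add: cong_def odd_iff_mod_2_eq_one)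
    qed simp
  qed
  then have "std_class t \<in> {std_class 1}" if "coprime t m" for t
    using that std_cong std_class_def by (metis singletonI)
  moreover have "std_class 1 \<in> std_class ` {t. coprime t m}" by simp
  ultimately have carrier: "carrier (class_group (chi a b)) = {std_class 1}"
    unfolding carrier_class_group by blast
  moreover have "group (class_group (chi a b))"
    by (rule groupI) (simp_all add: carrier one_class_group mult_class_group std_class_mult)
  ultimately show ?thesis by (simp add: trivial_group_def one_class_group)
qed

text \<open>The class group is the image of a group under a multiplicative map into \<open>ICM\<close>, and is a
  group for this reason; the isomorphism is then the first isomorphism theorem.\<close>

lemma class_group_iso:
  assumes "m > 2"
  shows "group (class_group (chi a b))"
    and "class_group (chi a b) \<cong> units_of (residue_ring m) Mod
          {\<one>\<^bsub>residue_ring m\<^esub>, \<ominus>\<^bsub>residue_ring m\<^esub> \<one>\<^bsub>residue_ring m\<^esub>}"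
proof -
  interpret residues m "residue_ring m"
    by unfold_locales (use assms in auto)
  let ?U = "units_of (residue_ring m)" and ?Cl = "class_group (chi a b)"
  have U: "group ?U" by (rule units_group)
  have carrier_U: "carrier ?U = {t. 0 < t \<and> t < m \<and> coprime t m}"
    by (simp add: units_of_carrier res_units_eq)
  have mod_class: "std_class (t mod m) = std_class t" for t
    using std_cong[of "t mod m" t] by (simp add: std_class_def)
  have hom_ICM: "std_class \<in> hom ?U (ICM (chi a b))"
  proof (rule homI)
    fix s t assume "s \<in> carrier ?U" "t \<in> carrier ?U"
    then show "std_class (s \<otimes>\<^bsub>?U\<^esub> t) = std_class s \<otimes>\<^bsub>ICM (chi a b)\<^esub> std_class t"
      by (simp add: carrier_U units_of_mult res_mult_eq mod_class std_class_mult)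
  next
    fix t
    show "std_class t \<in> carrier (ICM (chi a b))"
      unfolding std_class_def ICM_def by (simp add: quotientI fractional_std)
  qed
  have image: "std_class ` carrier ?U = carrier ?Cl"
  proof
    show "std_class ` carrier ?U \<subseteq> carrier ?Cl"
      by (auto simp: carrier_class_group carrier_U)
    have "std_class t \<in> std_class ` carrier ?U" if "coprime t m" for t
    proof -
      have "t mod m \<noteq> 0" using that assms by (auto simp: mod_eq_0_iff_dvd)
      then have "t mod m \<in> carrier ?U"
        using assms that pos_mod_bound[of m t] pos_mod_sign[of m t] by (simp add: carrier_U order_less_le)
      then show ?thesis using mod_class by (metis imageI)
    qed
    then show "carrier ?Cl \<subseteq> std_class ` carrier ?U" by (auto simp: carrier_class_group)
  qed
  have one: "\<one>\<^bsub>?U\<^esub> = 1" by (simp add: units_of_one res_one_eq)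
  have "(ICM (chi a b))\<lparr>carrier := std_class ` carrier ?U, one := std_class \<one>\<^bsub>?U\<^esub>\<rparr> = ?Cl"
    unfolding image using one_class_group unfolding one by (simp add: class_group_def ICM_def)
  then show Cl: "group ?Cl"
    using group.hom_imp_img_group[OF U hom_ICM] by simp
  have hom: "group_hom ?U ?Cl std_class"
  proof (intro group_hom.intro group_hom_axioms.intro U Cl)
    show "std_class \<in> hom ?U ?Cl"
      using hom_ICM image by (auto simp: hom_def mult_class_group)
  qed
  have kernel: "kernel ?U ?Cl std_class =
      {\<one>\<^bsub>residue_ring m\<^esub>, \<ominus>\<^bsub>residue_ring m\<^esub> \<one>\<^bsub>residue_ring m\<^esub>}"
  proof -
    have minus1: "- 1 mod m = m - 1" using assms by (simp add: zmod_minus1)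
    have "t \<in> kernel ?U ?Cl std_class \<longleftrightarrow> t = 1 \<or> t = m - 1" for t
    proof -
      have "t \<in> kernel ?U ?Cl std_class \<longleftrightarrow> t \<in> carrier ?U \<and> ([t = 1] (mod m) \<or> [t = - 1] (mod m))"
        using std_class_eq_iff[of t 1] by (auto simp: kernel_def one_class_group carrier_U)
      also have "\<dots> \<longleftrightarrow> t \<in> carrier ?U \<and> (t = 1 \<or> t = m - 1)"
        using assms by (auto simp: carrier_U cong_def minus1)
      also have "\<dots> \<longleftrightarrow> t = 1 \<or> t = m - 1"
        using assms by (auto simp: carrier_U coprime_diff_one_left)
      finally show ?thesis .
    qed
    then show ?thesis by (auto simp: res_neg_eq res_one_eq minus1)
  qed
  have "?U Mod kernel ?U ?Cl std_class \<cong> ?Cl"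
    using group_hom.FactGroup_iso_set[OF hom image] by (rule is_isoI)
  moreover have "group (?U Mod kernel ?U ?Cl std_class)"
    by (intro normal.factorgroup_is_group group_hom.normal_kernel hom)
  ultimately show "?Cl \<cong> ?U Mod {\<one>\<^bsub>residue_ring m\<^esub>, \<ominus>\<^bsub>residue_ring m\<^esub> \<one>\<^bsub>residue_ring m\<^esub>}"
    unfolding kernel by (rule group.iso_sym[rotated])
qed

end

theorem theorem5p2:
  fixes a b :: int
  assumes "a < b"
  shows "(b - a \<le> 2 \<longrightarrow> trivial_group (class_group (chi a b))) \<and>
    (b - a > 2 \<longrightarrow>
      group (class_group (chi a b)) \<and>
      class_group (chi a b) \<cong>
        units_of (residue_ring (b - a)) Mod
          {\<one>\<^bsub>residue_ring (b - a)\<^esub>, \<ominus>\<^bsub>residue_ring (b - a)\<^esub> \<one>\<^bsub>residue_ring (b - a)\<^esub>})"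
proof -
  interpret split_quadratic a b by (rule split_quadratic.intro) (rule assms)
  show ?thesis using trivial_class_group class_group_iso by blast
qed

end
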